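(* For each integer $r \geq 0$, let $E^{(r)}$ be the set of positive integers whose decimal representation contains the digit $9$ exactly $r$ times, and let $S^{(r)} := \sum_{k \in E^{(r)}} \frac{1}{k}$ (each such series is convergent). Then the sequence $(S^{(r)})_{r \geq 1}$ is decreasing and converges to $10 \log 10$. In particular, $S^{(r)} > 10 \log 10$ for all $r \geq 1$.
   Context: $\log$ denotes the natural logarithm. Decimal representations of positive integers are taken without leading zeros. *)

theory Defs
  imports "HOL-Analysis.Analysis"
begin

(* Least significant digit first; the empty list for 0, so that no list has
   superfluous leading zeros (zeros at its end). *)
fun decimal_digits :: "nat \<Rightarrow> nat list" where
  "decimal_digits n = (if n = 0 then [] else (n mod 10) # decimal_digits (n div 10))"

(* The unconditional recursive equation would make the simplifier loop. *)
declare decimal_digits.simps [simp del]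

definition nines_set :: "nat \<Rightarrow> nat set" where
  "nines_set r = {k. k > 0 \<and> count_list (decimal_digits k) 9 = r}"

definition nines_sum :: "nat \<Rightarrow> real" where
  "nines_sum r = (\<Sum>\<^sub>\<infinity>k\<in>nines_set r. 1 / real k)"

end

theory Submission
  imports Defs
begin

text \<open>
  Write \<open>U\<^sub>r(f)\<close> for the sum of \<open>f\<close> over the integers with exactly \<open>r\<close> nines. Splitting off the last
  digit gives, for \<open>r \<ge> 2\<close>,
  \<open>U\<^sub>r(f) = U\<^sub>r(k \<mapsto> \<Sum>d\<le>8. f(10k+d)) + U\<^sub>r\<^sub>-\<^sub>1(k \<mapsto> f(10k+9))\<close>, with the one-digit integers as additional
  terms when \<open>r \<le> 1\<close>.

  For \<open>f(k) = 1/k\<close> this yields \<open>S\<^sub>r < (9/10) S\<^sub>r + (1/10) S\<^sub>r\<^sub>-\<^sub>1\<close>, which is the monotonicity.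
  The function \<open>f(k) = ln ((k+1)/k)\<close> is the sum of its values at the ten integers \<open>10k+d\<close>, so
  that \<open>U\<^sub>r(k \<mapsto> f(10k+9))\<close> does not depend on \<open>r \<ge> 1\<close>; the one-digit terms show that it is
  \<open>ln 10\<close>. Since \<open>f(10k+9) \<ge> 1/(10(k+1))\<close> and every \<open>k\<close> with \<open>r\<close> nines is at least \<open>r\<close>,
  \<open>S\<^sub>r\<close> is asymptotically at most \<open>10 ln 10\<close>, whereas \<open>f(10k+9) < 1/(10k)\<close> gives the lower bound.
\<close>

section \<open>Appending a decimal digit and counting nines\<close>

definition prev_nines_set :: "nat \<Rightarrow> nat set" where
  "prev_nines_set r = (case r of 0 \<Rightarrow> {} | Suc s \<Rightarrow> nines_set s)"

lemma prev_nines_set_simps [simp]: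
  "prev_nines_set 0 = {}" "prev_nines_set (Suc r) = nines_set r"
  by (simp_all add: prev_nines_set_def)

lemma decimal_digits_0 [simp]: "decimal_digits 0 = []"
  by (simp add: decimal_digits.simps)

lemma decimal_digits_append_digit:
  assumes "d < 10" and "0 < 10 * m + d"
  shows "decimal_digits (10 * m + d) = d # decimal_digits m"
proof -
  have "(10 * m + d) mod 10 = d" "(10 * m + d) div 10 = m"
    using assms(1) by auto
  then show ?thesis
    using assms(2) by (subst decimal_digits.simps) simp
qed

lemma zero_notin_nines_set [simp]: "0 \<notin> nines_set r"
  by (simp add: nines_set_def)

lemma append_digit_in_nines_set:
  assumes "0 < m" and "d < 9"
  shows "10 * m + d \<in> nines_set r \<longleftrightarrow> m \<in> nines_set r"
  using assms by (simp add: nines_set_def decimal_digits_append_digit)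

text \<open>A final 9 uses up one of the \<open>r\<close> nines. For \<open>r = 0\<close> no such
  integer exists, which is why \<open>prev_nines_set 0\<close> is empty rather than defined through
  truncated subtraction.\<close>

lemma append_nine_in_nines_set:
  assumes "0 < m"
  shows "10 * m + 9 \<in> nines_set r \<longleftrightarrow> m \<in> prev_nines_set r"
  using assms decimal_digits_append_digit[of 9 m]
  by (cases r) (simp_all add: nines_set_def)

lemma digit_in_nines_set:
  assumes "0 < d" and "d < 10"
  shows "d \<in> nines_set r \<longleftrightarrow> r = (if d = 9 then 1 else 0)"
  using assms decimal_digits_append_digit[of d 0] by (auto simp: nines_set_def)

text \<open>Each digit adds at most one to the count, and \<open>k div 10 < k\<close> for positive
  \<open>k\<close>. For large \<open>r\<close> this makes 1/k and 1/(k+1) uniformly close in ratio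
  on \<open>nines_set r\<close>.\<close>

lemma le_of_mem_nines_set:
  assumes "k \<in> nines_set r"
  shows "r \<le> k"
proof -
  have "count_list (decimal_digits k) 9 \<le> k" for k
  proof (induction k rule: less_induct)
    case (less k)
    show ?case
    proof (cases "k = 0")
      case False
      then have "k div 10 < k" by simp
      with less[of "k div 10"] show ?thesis
        by (subst decimal_digits.simps) auto
    qed simp
  qed
  with assms show ?thesis by (auto simp: nines_set_def)
qed

section \<open>Restricted series and their grouping in blocks of ten\<close>

definition nines_weighted :: "nat \<Rightarrow> (nat \<Rightarrow> real) \<Rightarrow> nat \<Rightarrow> real" where
  "nines_weighted r f k = indicator (nines_set r) k * f k"

definition nines_series :: "nat \<Rightarrow> (nat \<Rightarrow> real) \<Rightarrow> real" where
  "nines_series r f = (\<Sum>k. nines_weighted r f k)"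

text \<open>The contribution of the block from 10m to 10m+9. The block \<open>m = 0\<close> is
  separate: its one-digit integers do not arise by appending a digit to a positive integer.\<close>

definition last_digit_group :: "nat \<Rightarrow> (nat \<Rightarrow> real) \<Rightarrow> nat \<Rightarrow> real" where
  "last_digit_group r f m = (if m = 0 then \<Sum>d\<in>{1..9}. nines_weighted r f d
     else indicator (nines_set r) m * (\<Sum>d<9. f (10 * m + d))
        + indicator (prev_nines_set r) m * f (10 * m + 9))"

lemma sum_nines_weighted_block:
  "sum (nines_weighted r f) {m * 10..<m * 10 + 10} = last_digit_group r f m"
proof (cases "m = 0")
  case True
  have "{0..<10::nat} = insert 0 {1..9}" by auto
  then have "sum (nines_weighted r f) {0..<10} = nines_weighted r f 0 + sum (nines_weighted r f) {1..9}"
    by simp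
  moreover have "nines_weighted r f 0 = 0" by (simp add: nines_weighted_def)
  ultimately show ?thesis
    using True by (simp add: last_digit_group_def)
next
  case False
  have "sum (nines_weighted r f) {m * 10..<m * 10 + 10}
      = (\<Sum>d<10. nines_weighted r f (10 * m + d))"
    using sum.shift_bounds_nat_ivl[of "nines_weighted r f" 0 "m * 10" 10]
    by (simp add: atLeast0LessThan ac_simps)
  also have "\<dots> = (\<Sum>d<9. nines_weighted r f (10 * m + d)) + nines_weighted r f (10 * m + 9)"
    using sum.lessThan_Suc[of "\<lambda>d. nines_weighted r f (10 * m + d)" 9] by simp
  also have "(\<Sum>d<9. nines_weighted r f (10 * m + d))
      = (\<Sum>d<9. indicator (nines_set r) m * f (10 * m + d))"
    using False by (intro sum.cong)
      (auto simp: nines_weighted_def indicator_def append_digit_in_nines_set)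
  also have "nines_weighted r f (10 * m + 9) = indicator (prev_nines_set r) m * f (10 * m + 9)"
    using False by (simp add: nines_weighted_def indicator_def append_nine_in_nines_set)
  finally show ?thesis
    using False by (simp add: last_digit_group_def sum_distrib_left)
qed

lemma sums_last_digit_group:
  assumes "summable (nines_weighted r f)"
  shows "last_digit_group r f sums nines_series r f"
  using sums_group[OF summable_sums[OF assms], of 10]
  by (simp add: sum_nines_weighted_block nines_series_def)

section \<open>Convergence of the reciprocal series\<close>

lemma sum_inverse_append_digits_le:
  assumes "0 < m"
  shows "(\<Sum>d<9. 1 / real (10 * m + d)) \<le> 9 / 10 * (1 / real m)"
proof -
  have "(\<Sum>d<9. 1 / real (10 * m + d)) \<le> (\<Sum>d<9::nat. 1 / real (10 * m))"
    using assms by (intro sum_mono) (simp add: frac_le)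
  then show ?thesis by simp
qed

lemma last_digit_group_inverse_le:
  assumes "0 < m"
  shows "last_digit_group r (\<lambda>k. 1 / real k) m
    \<le> 9 / 10 * nines_weighted r (\<lambda>k. 1 / real k) m
      + indicator (prev_nines_set r) m * (1 / real (10 * m + 9))"
  using assms sum_inverse_append_digits_le[OF assms]
  by (simp add: last_digit_group_def nines_weighted_def indicator_def)

lemma nines_weighted_nonneg:
  assumes "\<And>k. 0 \<le> f k"
  shows "0 \<le> nines_weighted r f k"
  by (simp add: nines_weighted_def assms)

text \<open>Lengths that are powers of ten let the grouping by last digit reduce
  \<open>n + 1\<close> to \<open>n\<close>. The bound B(r) = 90(r+1) solves B(r) = 9 + (9/10) B(r) +
  (1/10) B(r-1) with B(-1) = 0.\<close>

lemma sum_nines_weighted_inverse_le: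
  "(\<Sum>k<10 ^ n. nines_weighted r (\<lambda>k. 1 / real k) k) \<le> 90 * (real r + 1)"
proof (induction n arbitrary: r)
  case 0
  show ?case by (simp add: nines_weighted_def)
next
  case (Suc n)
  let ?w = "\<lambda>r. nines_weighted r (\<lambda>k. 1 / real k)"
  let ?p = "\<lambda>m. indicator (prev_nines_set r) m * (1 / real m)"
  have prev: "(\<Sum>m<10 ^ n. ?p m) \<le> 90 * real r"
    using Suc.IH[of "r - 1"] by (cases r) (simp_all add: nines_weighted_def algebra_simps)
  \<comment> \<open>The 9 bounds the nine one-digit terms crudely by 1 each; at \<open>m = 0\<close>
    the remaining terms vanish.\<close>
  have group: "last_digit_group r (\<lambda>k. 1 / real k) m
      \<le> (if m = 0 then 9 else 0) + (9 / 10 * ?w r m + 1 / 10 * ?p m)" for m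
  proof (cases "m = 0")
    case True
    have "(\<Sum>d\<in>{1..9}. ?w r d) \<le> (\<Sum>d\<in>{1..9::nat}. 1)"
      by (intro sum_mono) (auto simp: nines_weighted_def indicator_def)
    with True show ?thesis
      by (simp add: last_digit_group_def nines_weighted_def)
  next
    case False
    have "1 / real (10 * m + 9) \<le> 1 / 10 * (1 / real m)"
      using False by (simp add: field_simps)
    then have "indicator (prev_nines_set r) m * (1 / real (10 * m + 9)) \<le> 1 / 10 * ?p m"
      by (simp add: indicator_def)
    with False last_digit_group_inverse_le[of m r] show ?thesis by simp
  qed
  have "(\<Sum>k<10 ^ Suc n. ?w r k) = (\<Sum>m<10 ^ n. last_digit_group r (\<lambda>k. 1 / real k) m)"
    using sum.nat_group[of "?w r" 10 "10 ^ n"]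
    by (simp add: sum_nines_weighted_block mult.commute)
  also have "\<dots> \<le> (\<Sum>m<10 ^ n. (if m = 0 then 9 else 0) + (9 / 10 * ?w r m + 1 / 10 * ?p m))"
    by (intro sum_mono group)
  also have "\<dots> = 9 + 9 / 10 * (\<Sum>m<10 ^ n. ?w r m) + 1 / 10 * (\<Sum>m<10 ^ n. ?p m)"
    by (simp only: sum.distrib sum_distrib_left[symmetric]) simp
  also have "\<dots> \<le> 90 * (real r + 1)"
    using Suc.IH[of r] prev by (simp add: algebra_simps)
  finally show ?case .
qed

lemma summable_nines_weighted_inverse: "summable (nines_weighted r (\<lambda>k. 1 / real k))"
proof (rule summableI_nonneg_bounded)
  show "(\<Sum>k<n. nines_weighted r (\<lambda>k. 1 / real k) k) \<le> 90 * (real r + 1)" for n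
  proof -
    \<comment> \<open>As the terms are nonnegative, any partial sum may be lengthened to a power of
      ten.\<close>
    have "n \<le> 10 ^ n"
      by (rule less_imp_le) (rule power_gt_expt, simp)
    then have "(\<Sum>k<n. nines_weighted r (\<lambda>k. 1 / real k) k)
        \<le> (\<Sum>k<10 ^ n. nines_weighted r (\<lambda>k. 1 / real k) k)"
      by (intro sum_mono2) (auto simp: nines_weighted_nonneg)
    with sum_nines_weighted_inverse_le[of r n] show ?thesis by linarith
  qed
qed (simp add: nines_weighted_nonneg)

lemma summable_nines_weighted:
  assumes "\<And>k. 0 < k \<Longrightarrow> 0 \<le> f k \<and> f k \<le> 1 / real k"
  shows "summable (nines_weighted r f)"
proof (rule summable_comparison_test'[OF summable_nines_weighted_inverse])
  show "norm (nines_weighted r f k) \<le> nines_weighted r (\<lambda>k. 1 / real k) k" for k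
    using assms[of k] by (cases "k = 0") (auto simp: nines_weighted_def indicator_def)
qed

section \<open>Comparison and scaling of restricted series\<close>

lemma nines_series_mono:
  assumes "summable (nines_weighted r f)" and "summable (nines_weighted r g)"
    and "\<And>k. k \<in> nines_set r \<Longrightarrow> f k \<le> g k"
  shows "nines_series r f \<le> nines_series r g"
  unfolding nines_series_def
  using assms by (intro suminf_le) (auto simp: nines_weighted_def indicator_def)

lemma nines_series_cmult:
  assumes "summable (nines_weighted r f)"
  shows "nines_series r (\<lambda>k. c * f k) = c * nines_series r f"
    and "summable (nines_weighted r (\<lambda>k. c * f k))"
proof -
  have "nines_weighted r (\<lambda>k. c * f k) = (\<lambda>k. c * nines_weighted r f k)"
    by (simp add: nines_weighted_def fun_eq_iff)
  then show "nines_series r (\<lambda>k. c * f k) = c * nines_series r f"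
    and "summable (nines_weighted r (\<lambda>k. c * f k))"
    using assms by (simp_all add: nines_series_def suminf_mult summable_mult)
qed

lemma nines_series_strict_mono:
  assumes "summable (nines_weighted r f)" and "summable (nines_weighted r g)"
    and "\<And>k. k \<in> nines_set r \<Longrightarrow> f k < g k" and "nines_set r \<noteq> {}"
  shows "nines_series r f < nines_series r g"
proof -
  obtain i where i: "i \<in> nines_set r" using assms(4) by blast
  have "0 < (\<Sum>k. nines_weighted r g k - nines_weighted r f k)"
  proof (rule suminf_pos2[of _ i])
    show "0 \<le> nines_weighted r g k - nines_weighted r f k" for k
      using assms(3)[of k] by (auto simp: nines_weighted_def indicator_def)
    show "0 < nines_weighted r g i - nines_weighted r f i"
      using assms(3)[OF i] i by (simp add: nines_weighted_def)
  qed (intro summable_diff assms)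
  also have "\<dots> = nines_series r g - nines_series r f"
    unfolding nines_series_def by (rule suminf_diff[symmetric]) (fact assms)+
  finally show ?thesis by simp
qed

section \<open>Logarithmic increments, the integrals of 1/x over [k, k+1]\<close>

definition log_step :: "nat \<Rightarrow> real" where
  "log_step k = ln (real (k + 1)) - ln (real k)"

lemma log_step_bounds:
  assumes "0 < k"
  shows "1 / (real k + 1) \<le> log_step k" and "log_step k \<le> 1 / real k"
proof -
  have "ln (real k / (real k + 1)) \<le> real k / (real k + 1) - 1"
    using assms by (intro ln_le_minus_one) simp
  also have "\<dots> = - (1 / (real k + 1))" by (simp add: field_simps)
  finally show "1 / (real k + 1) \<le> log_step k"
    using assms by (simp add: log_step_def ln_div add.commute)
  have "ln ((real k + 1) / real k) \<le> (real k + 1) / real k - 1"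
    using assms by (intro ln_le_minus_one) simp
  also have "\<dots> = 1 / real k" using assms by (simp add: field_simps)
  finally show "log_step k \<le> 1 / real k"
    using assms by (simp add: log_step_def ln_div add.commute)
qed

lemma sum_log_step: "(\<Sum>d<n. log_step (m + d)) = ln (real (m + n)) - ln (real m)"
  by (induction n) (simp_all add: log_step_def)

text \<open>Scale invariance of the logarithm: multiplying the endpoints m and m+1 by 10 leaves the
  increment unchanged, and [10m, 10m+10] splits into ten unit intervals.\<close>

lemma log_step_eq_sum_append_digit:
  assumes "0 < m"
  shows "log_step m = (\<Sum>d<9. log_step (10 * m + d)) + log_step (10 * m + 9)"
proof -
  have "log_step m = ln (10 * real (m + 1)) - ln (10 * real m)"
    using assms by (simp only: log_step_def) (subst (1 2) ln_mult; simp)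
  also have "\<dots> = (\<Sum>d<10. log_step (10 * m + d))"
    by (subst sum_log_step) (simp add: algebra_simps)
  also have "\<dots> = (\<Sum>d<9. log_step (10 * m + d)) + log_step (10 * m + 9)"
    using sum.lessThan_Suc[of "\<lambda>d. log_step (10 * m + d)" 9] by simp
  finally show ?thesis .
qed

lemma summable_nines_weighted_log_step: "summable (nines_weighted r log_step)"
proof (intro summable_nines_weighted conjI)
  fix k :: nat assume k: "0 < k"
  show "0 \<le> log_step k"
    using log_step_bounds(1)[OF k] by (rule order_trans[rotated]) simp
  show "log_step k \<le> 1 / real k" by (rule log_step_bounds(2)[OF k])
qed

text \<open>The successor of 10k+9 is 10(k+1), which gives the lower bound its simple form.\<close>

lemma log_step_append_nine_bounds:
  shows "1 / (10 * (real k + 1)) \<le> log_step (10 * k + 9)"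
    and "log_step (10 * k + 9) \<le> 1 / real (10 * k + 9)"
  using log_step_bounds[of "10 * k + 9"] by (simp_all add: algebra_simps)

lemma summable_nines_weighted_inverse_append_nine:
  "summable (nines_weighted r (\<lambda>k. 1 / real (10 * k + 9)))"
  by (intro summable_nines_weighted) (simp add: frac_le)

lemma summable_nines_weighted_log_step_append_nine:
  "summable (nines_weighted r (\<lambda>k. log_step (10 * k + 9)))"
proof (intro summable_nines_weighted conjI)
  fix k :: nat assume k: "0 < k"
  show "0 \<le> log_step (10 * k + 9)"
    using log_step_append_nine_bounds(1)[of k] by (rule order_trans[rotated]) simp
  have "1 / real (10 * k + 9) \<le> 1 / real k" using k by (simp add: frac_le)
  with log_step_append_nine_bounds(2)[of k]
  show "log_step (10 * k + 9) \<le> 1 / real k" by linarith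
qed

section \<open>Exact evaluation of the logarithmic series over integers followed by a 9\<close>

lemma suminf_prev_nines_set:
  "(\<Sum>k. indicator (prev_nines_set r) k * f k) = (case r of 0 \<Rightarrow> 0 | Suc s \<Rightarrow> nines_series s f)"
  by (cases r) (simp_all add: nines_series_def nines_weighted_def)

lemma summable_prev_nines_set:
  assumes "\<And>s. summable (nines_weighted s f)"
  shows "summable (\<lambda>k. indicator (prev_nines_set r) k * f k)"
  using assms[of "r - 1"] by (cases r) (simp_all add: nines_weighted_def[abs_def])

text \<open>The digits 1 to 8 contain no nine and telescope from ln 1 to ln 9; the digit 9 alone
  supplies ln 10 - ln 9.\<close>

lemma sum_digits_log_step:
  "(\<Sum>d\<in>{1..9}. nines_weighted r log_step d)
    = (if r = 0 then ln 9 else if r = 1 then ln 10 - ln 9 else 0)"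
proof -
  have range: "{1..9::nat} = insert 9 {1..8}" by auto
  have "(\<Sum>d\<in>{1..9}. nines_weighted r log_step d)
      = (if r = 1 then log_step 9 else 0) + (\<Sum>d\<in>{1..8}. if r = 0 then log_step d else 0)"
    unfolding range
    by (subst sum.insert)
      (auto simp: nines_weighted_def indicator_def digit_in_nines_set intro!: sum.cong)
  moreover have "(\<Sum>d\<in>{1..8}. log_step d) = ln 9"
    using sum_log_step[of 1 8] sum.shift_bounds_nat_ivl[of log_step 0 1 8]
    by (simp add: atLeast0LessThan atLeastLessThanSuc_atLeastAtMost numeral_eq_Suc)
  ultimately show ?thesis by (simp add: log_step_def)
qed

text \<open>By scale invariance, the digits below 9 contribute \<open>log_step m\<close> minus
  \<open>log_step (10 * m + 9)\<close> for each positive \<open>m\<close> in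
  \<open>nines_set r\<close>. Hence the convergent series of \<open>log_step\<close> appears on both
  sides of the grouping identity and cancels.\<close>

lemma nines_series_log_step_append_nine_rec:
  "nines_series r (\<lambda>k. log_step (10 * k + 9))
    = (\<Sum>d\<in>{1..9}. nines_weighted r log_step d)
      + (case r of 0 \<Rightarrow> 0 | Suc s \<Rightarrow> nines_series s (\<lambda>k. log_step (10 * k + 9)))"
proof -
  let ?R = "\<lambda>k. log_step (10 * k + 9)"
  let ?D = "\<Sum>d\<in>{1..9}. nines_weighted r log_step d"
  let ?p = "\<lambda>m. indicator (prev_nines_set r) m * ?R m"
  have group: "last_digit_group r log_step m
      = (if m = 0 then ?D else 0) + (nines_weighted r log_step m - nines_weighted r ?R m + ?p m)" for m
  proof (cases "m = 0")
    case True
    have "0 \<notin> prev_nines_set r" by (cases r) simp_all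
    with True show ?thesis by (simp add: last_digit_group_def nines_weighted_def)
  next
    case False
    then show ?thesis
      using log_step_eq_sum_append_digit[of m]
      by (simp add: last_digit_group_def nines_weighted_def algebra_simps)
  qed
  have "(\<lambda>m. (if m = 0 then ?D else 0) + (nines_weighted r log_step m - nines_weighted r ?R m + ?p m))
      sums (?D + (nines_series r log_step - nines_series r ?R + (\<Sum>m. ?p m)))"
    unfolding nines_series_def
    by (intro sums_add sums_diff summable_sums summable_prev_nines_set sums_single
        summable_nines_weighted_log_step summable_nines_weighted_log_step_append_nine)
  then have "last_digit_group r log_step
      sums (?D + (nines_series r log_step - nines_series r ?R + (\<Sum>m. ?p m)))"
    by (simp only: group[symmetric])
  with sums_last_digit_group[OF summable_nines_weighted_log_step[of r]]
  have "nines_series r log_step = ?D + (nines_series r log_step - nines_series r ?R + (\<Sum>m. ?p m))"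
    by (rule sums_unique2)
  then show ?thesis by (simp add: suminf_prev_nines_set)
qed

text \<open>The recursion starts at ln 9, gains ln 10 - ln 9 at \<open>r = 1\<close>, and gains
  nothing afterwards.\<close>

lemma nines_series_log_step_append_nine:
  "nines_series r (\<lambda>k. log_step (10 * k + 9)) = (if r = 0 then ln 9 else ln 10)"
proof (induction r)
  case 0
  show ?case
    using nines_series_log_step_append_nine_rec[of 0] unfolding sum_digits_log_step by simp
next
  case (Suc r)
  then show ?case
    using nines_series_log_step_append_nine_rec[of "Suc r"] unfolding sum_digits_log_step by simp
qed

text \<open>A series with the nonzero value ln 10 cannot range over the empty set, so no explicit
  element has to be exhibited.\<close>

lemma nines_set_nonempty:
  assumes "1 \<le> r"
  shows "nines_set r \<noteq> {}"
proof
  assume "nines_set r = {}"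
  then have "nines_series r (\<lambda>k. log_step (10 * k + 9)) = 0"
    by (simp add: nines_series_def nines_weighted_def)
  with assms show False by (simp add: nines_series_log_step_append_nine)
qed

section \<open>Monotonicity and two-sided bounds for the reciprocal series\<close>

lemma nines_series_inverse_Suc_less:
  assumes "1 \<le> r"
  shows "nines_series (Suc r) (\<lambda>k. 1 / real k) < nines_series r (\<lambda>k. 1 / real k)"
proof -
  let ?f = "\<lambda>k. 1 / real k"
  let ?g = "\<lambda>k. 1 / real (10 * k + 9)"
  note summable = summable_nines_weighted_inverse
  \<comment> \<open>Here \<open>Suc r\<close> is at least 2, while a one-digit integer has at most
    one nine.\<close>
  have no_digit: "nines_weighted (Suc r) ?f d = 0" if "d \<in> {1..9}" for d
    using that assms by (simp add: nines_weighted_def indicator_def digit_in_nines_set)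
  have "last_digit_group (Suc r) ?f m \<le> 9 / 10 * nines_weighted (Suc r) ?f m + nines_weighted r ?g m" for m
    using last_digit_group_inverse_le[of m "Suc r"] no_digit
    by (cases "m = 0") (simp_all add: last_digit_group_def nines_weighted_def)
  moreover have "(\<lambda>m. 9 / 10 * nines_weighted (Suc r) ?f m + nines_weighted r ?g m)
      sums (9 / 10 * nines_series (Suc r) ?f + nines_series r ?g)"
    unfolding nines_series_def
    by (intro sums_add sums_mult summable_sums summable summable_nines_weighted_inverse_append_nine)
  ultimately have "nines_series (Suc r) ?f \<le> 9 / 10 * nines_series (Suc r) ?f + nines_series r ?g"
    by (rule sums_le[OF _ sums_last_digit_group[OF summable]])
  also have "nines_series r ?g < nines_series r (\<lambda>k. 1 / 10 * ?f k)"
  proof (rule nines_series_strict_mono)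
    show "?g k < 1 / 10 * ?f k" if "k \<in> nines_set r" for k
    proof -
      have "0 < k" using that by (cases k) simp_all
      then show ?thesis by (simp add: field_simps)
    qed
  qed (intro nines_series_cmult summable summable_nines_weighted_inverse_append_nine
      nines_set_nonempty assms)+
  also have "\<dots> = 1 / 10 * nines_series r ?f"
    by (rule nines_series_cmult(1)[OF summable])
  finally show ?thesis by simp
qed

lemma nines_series_inverse_ge:
  assumes "1 \<le> r"
  shows "10 * ln 10 \<le> nines_series r (\<lambda>k. 1 / real k)"
proof -
  let ?f = "\<lambda>k. 1 / real k"
  have "ln 10 = nines_series r (\<lambda>k. log_step (10 * k + 9))"
    using assms by (simp add: nines_series_log_step_append_nine)
  also have "\<dots> \<le> nines_series r (\<lambda>k. 1 / 10 * ?f k)"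
  proof (rule nines_series_mono)
    show "log_step (10 * k + 9) \<le> 1 / 10 * ?f k" if "k \<in> nines_set r" for k
    proof -
      have "0 < k" using that by (cases k) simp_all
      then have "1 / real (10 * k + 9) \<le> 1 / 10 * ?f k" by (simp add: field_simps)
      with log_step_append_nine_bounds(2)[of k] show ?thesis by linarith
    qed
  qed (intro nines_series_cmult summable_nines_weighted_inverse
      summable_nines_weighted_log_step_append_nine)+
  also have "\<dots> = 1 / 10 * nines_series r ?f"
    by (rule nines_series_cmult(1)[OF summable_nines_weighted_inverse])
  finally show ?thesis by simp
qed

lemma nines_series_inverse_le:
  assumes "1 \<le> r"
  shows "nines_series r (\<lambda>k. 1 / real k) \<le> (1 + 1 / real r) * (10 * ln 10)"
proof -
  \<comment> \<open>The constant comes from 1/k = 10 (1 + 1/k) / (10(k+1)), with 1/k replaced by the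
    larger 1/r.\<close>
  let ?c = "(1 + 1 / real r) * 10"
  have "nines_series r (\<lambda>k. 1 / real k) \<le> nines_series r (\<lambda>k. ?c * log_step (10 * k + 9))"
  proof (rule nines_series_mono)
    show "1 / real k \<le> ?c * log_step (10 * k + 9)" if "k \<in> nines_set r" for k
    proof -
      have "r \<le> k" by (rule le_of_mem_nines_set[OF that])
      with assms have "1 / real k \<le> 1 / real r" by (simp add: frac_le)
      have "1 / real k = (1 + 1 / real k) * 10 * (1 / (10 * (real k + 1)))"
        using \<open>r \<le> k\<close> assms by (simp add: field_simps)
      also have "\<dots> \<le> ?c * (1 / (10 * (real k + 1)))"
        using \<open>1 / real k \<le> 1 / real r\<close> by (intro mult_right_mono) simp_all
      also have "\<dots> \<le> ?c * log_step (10 * k + 9)"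
        by (intro mult_left_mono log_step_append_nine_bounds) simp
      finally show ?thesis .
    qed
  qed (intro nines_series_cmult summable_nines_weighted_inverse
      summable_nines_weighted_log_step_append_nine)+
  also have "\<dots> = ?c * ln 10"
    using assms
    by (simp add: nines_series_cmult(1)[OF summable_nines_weighted_log_step_append_nine]
        nines_series_log_step_append_nine)
  finally show ?thesis by (simp only: mult.assoc)
qed

section \<open>Passage to unordered sums and conclusion\<close>

lemma has_sum_inverse_nines_set:
  "((\<lambda>k. 1 / real k) has_sum nines_series r (\<lambda>k. 1 / real k)) (nines_set r)"
proof -
  \<comment> \<open>Nonnegative terms make the ordered series absolutely convergent, so it has the
    same unordered sum.\<close>
  have "(nines_weighted r (\<lambda>k. 1 / real k) has_sum nines_series r (\<lambda>k. 1 / real k)) UNIV"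
    unfolding nines_series_def
    by (intro norm_summable_imp_has_sum summable_sums summable_nines_weighted_inverse)
      (simp add: nines_weighted_nonneg summable_nines_weighted_inverse)
  then show ?thesis
    by (subst has_sum_cong_neutral[where T = UNIV and g = "nines_weighted r (\<lambda>k. 1 / real k)"])
      (simp_all add: nines_weighted_def)
qed

lemma nines_sum_eq: "nines_sum r = nines_series r (\<lambda>k. 1 / real k)"
  unfolding nines_sum_def by (rule infsumI[OF has_sum_inverse_nines_set])

theorem theorem1:
  shows "(\<forall>r. (\<lambda>k. 1 / real k) summable_on nines_set r)
    \<and> strict_antimono_on {1..} nines_sum
    \<and> nines_sum \<longlonglongrightarrow> 10 * ln 10
    \<and> (\<forall>r\<ge>1. nines_sum r > 10 * ln 10)"
proof (intro conjI allI impI)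
  show "(\<lambda>k. 1 / real k) summable_on nines_set r" for r
    using has_sum_inverse_nines_set by (rule has_sum_imp_summable)
  have decreasing: "nines_sum (Suc r) < nines_sum r" if "1 \<le> r" for r
    using nines_series_inverse_Suc_less[OF that] by (simp add: nines_sum_eq)
  have "nines_sum s < nines_sum r" if "1 \<le> r" "Suc r \<le> s" for r s
    using \<open>Suc r \<le> s\<close>
  proof (induction s rule: dec_induct)
    case base
    show ?case by (rule decreasing[OF \<open>1 \<le> r\<close>])
  next
    case (step n)
    with decreasing[of n] show ?case by simp
  qed
  then show "strict_antimono_on {1..} nines_sum"
    by (auto intro!: monotone_onI)
  show "nines_sum \<longlonglongrightarrow> 10 * ln 10"
  proof (rule tendsto_sandwich)
    show "\<forall>\<^sub>F r in sequentially. 10 * ln 10 \<le> nines_sum r"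
      using eventually_ge_at_top[of 1]
      by eventually_elim (simp add: nines_sum_eq nines_series_inverse_ge)
    show "\<forall>\<^sub>F r in sequentially. nines_sum r \<le> (1 + 1 / real r) * (10 * ln 10)"
      using eventually_ge_at_top[of 1]
      by eventually_elim (simp only: nines_sum_eq nines_series_inverse_le)
    have "(\<lambda>r. (1 + 1 / real r) * (10 * ln 10)) \<longlonglongrightarrow> (1 + 0) * (10 * ln 10)"
      by (intro tendsto_intros lim_1_over_n)
    then show "(\<lambda>r. (1 + 1 / real r) * (10 * ln 10)) \<longlonglongrightarrow> 10 * ln 10" by simp
  qed simp
  \<comment> \<open>Strictness comes from the decrease: the weak bound is applied at
    \<open>Suc r\<close>.\<close>
  show "10 * ln 10 < nines_sum r" if "1 \<le> r" for r
    using nines_series_inverse_ge[of "Suc r"] decreasing[OF that] by (simp add: nines_sum_eq)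
qed

end
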